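(* Let $p(z)$ be analytic in $\mathbb{U}$ with $p(0)=1$, and let $\alpha,\beta$ be real numbers with $0\leq\alpha<1$ and $\beta\neq 0$. Suppose that there exists a point $z_0\in\mathbb{U}$ such that $\operatorname{Re}(p(z))>\alpha$ for all $z$ with $|z|<|z_0|$, and $p(z_0)=\alpha+\beta i$. Then there exists a real number $k$ such that $$\operatorname{Re}\left(\frac{z_0p'(z_0)}{p(z_0)}\right)=-\frac{\alpha\beta k}{\alpha^2+\beta^2}\leq 0$$ and $$\operatorname{Im}\left(\frac{z_0p'(z_0)}{p(z_0)}\right)=\frac{\beta^2k}{\alpha^2+\beta^2},$$ where $$k\geq\frac12\left(\frac{\beta}{1-\alpha}+\frac{1-\alpha}{\beta}\right)\geq 1\quad\text{if }\beta>0,$$ and $$k\leq\frac12\left(\frac{\beta}{1-\alpha}+\frac{1-\alpha}{\beta}\right)\leq -1\quad\text{if }\beta<0.$$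
   Context: $\mathbb{U}=\{z\in\mathbb{C}:|z|<1\}$ denotes the open unit disk in the complex plane. *)

theory Defs
  imports "HOL-Complex_Analysis.Complex_Analysis"
begin

end

theory Submission
  imports Defs
begin

text \<open>
  Rotating and rescaling by \<open>z\<^sub>0\<close>, set \<open>f z = p (z\<^sub>0 z)\<close>; then \<open>f\<close> maps the unit disc into
  the half-plane \<open>Re > \<alpha>\<close>, sends \<open>0\<close> to \<open>1\<close> and reaches the boundary line at \<open>1\<close>, and
  \<open>f' 1 = z\<^sub>0 p' z\<^sub>0 =: c\<close>. Two one-variable extremum arguments determine \<open>c\<close> well enough.

  Along the unit circle \<open>Re f\<close> has a minimum at \<open>1\<close>, so its tangential derivative vanishes
  there, which says that \<open>c\<close> is real (\<open>boundary_deriv_real\<close>). Along the radius, the Schwarz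
  lemma, applied to \<open>f\<close> followed by the Moebius map of the half-plane onto the disc that sends
  \<open>1\<close> to \<open>0\<close>, bounds that map by \<open>t\<close> at \<open>t < 1\<close> (\<open>halfplane_Schwarz\<close>), while equality
  holds at \<open>t = 1\<close>. Comparing derivatives at \<open>t = 1\<close> gives the sharp estimate
  \<open>-2 (1 - \<alpha>) c \<ge> (1 - \<alpha>)\<^sup>2 + \<beta>\<^sup>2\<close> (\<open>boundary_deriv_bound\<close>).

  Dividing the real number \<open>c\<close> by \<open>p z\<^sub>0 = \<alpha> + \<beta> \<i>\<close> yields the two displayed formulas with
  \<open>k = -c / \<beta>\<close>, and the estimate on \<open>c\<close> becomes the estimate on \<open>k\<close>.
\<close>

text \<open>
  The map \<open>w \<mapsto> (w - 1) / (w + 1 - 2 \<alpha>)\<close> compares the distances of \<open>w\<close> to \<open>1\<close> and to the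
  mirror image \<open>2 \<alpha> - 1\<close> of \<open>1\<close> in the line \<open>Re w = \<alpha>\<close>; it therefore sends the half-plane
  to the right of the line into the unit disc, and the Schwarz lemma applies. Stating the result
  without a quotient keeps the later differentiation polynomial.
\<close>

lemma halfplane_Schwarz:
  fixes f :: "complex \<Rightarrow> complex" and \<alpha> :: real
  assumes holo: "f holomorphic_on ball 0 1" and f0: "f 0 = 1" and "\<alpha> < 1"
    and Re: "\<And>z. cmod z < 1 \<Longrightarrow> Re (f z) > \<alpha>"
    and z: "cmod z < 1"
  shows "cmod (f z - 1) \<le> cmod z * cmod (f z + 1 - 2 * of_real \<alpha>)"
proof -
  define w where "w = (\<lambda>z. (f z - 1) / (f z + 1 - 2 * of_real \<alpha>))"
  have nz: "f z + 1 - 2 * of_real \<alpha> \<noteq> 0" if "cmod z < 1" for z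
  proof
    assume "f z + 1 - 2 * of_real \<alpha> = 0"
    then have "Re (f z + 1 - 2 * of_real \<alpha>) = 0" by simp
    then show False using Re[OF that] \<open>\<alpha> < 1\<close> by simp
  qed
  have lt: "cmod (w z) < 1" if "cmod z < 1" for z
  proof -
    have "0 < (1 - \<alpha>) * (Re (f z) - \<alpha>)"
      using Re[OF that] \<open>\<alpha> < 1\<close> by simp
    then have "(cmod (f z - 1))\<^sup>2 < (cmod (f z + 1 - 2 * of_real \<alpha>))\<^sup>2"
      unfolding cmod_power2 by (simp add: power2_eq_square algebra_simps)
    then have "cmod (f z - 1) < cmod (f z + 1 - 2 * of_real \<alpha>)"
      by (rule power_less_imp_less_base) simp
    then show ?thesis using nz[OF that] by (simp add: w_def norm_divide)
  qed
  have "w holomorphic_on ball 0 1"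
    unfolding w_def using nz by (intro holomorphic_intros holo) auto
  moreover have "w 0 = 0" by (simp add: w_def f0)
  ultimately have "cmod (w z) \<le> cmod z"
    using Schwarz_Lemma(1)[of w z] lt z by blast
  then show ?thesis using nz[OF z] by (simp add: w_def norm_divide field_simps)
qed

text \<open>
  The real part of \<open>\<i> * c\<close>, the derivative of \<open>f\<close> in the direction of the circle, vanishes
  because \<open>Re f\<close> is minimal at \<open>1\<close> among the points of the circle.
\<close>

lemma boundary_deriv_real:
  fixes f :: "complex \<Rightarrow> complex" and \<alpha> :: real
  assumes cont: "continuous_on (cball 0 1) f"
    and Re: "\<And>z. cmod z < 1 \<Longrightarrow> Re (f z) > \<alpha>"
    and f1: "Re (f 1) = \<alpha>"
    and deriv: "(f has_field_derivative c) (at 1)"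
  shows "Im c = 0"
proof -
  have ge: "Re (f z) \<ge> \<alpha>" if "z \<in> cball 0 1" for z
  proof -
    have "continuous_on (closure (ball 0 1)) (\<lambda>z. Re (f z))"
      using cont by (intro continuous_intros) simp
    then show ?thesis
      by (rule continuous_ge_on_closure) (use that Re in \<open>auto intro: less_imp_le\<close>)
  qed
  have "(cis has_vector_derivative \<i>) (at 0)"
    by (auto simp: has_vector_derivative_complex_iff intro!: derivative_eq_intros)
  then have "((\<lambda>t. f (cis t)) has_vector_derivative (\<i> * c)) (at 0)"
    using field_vector_diff_chain_at[of cis \<i> 0 f c] deriv
    by (simp add: o_def)
  then have "((\<lambda>t. Re (f (cis t))) has_real_derivative Re (\<i> * c)) (at 0)"
    by (simp add: has_vector_derivative_complex_iff)
  then have "Re (\<i> * c) = 0"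
    by (rule DERIV_local_min[where d = 1]) (auto simp: f1 ge)
  then show ?thesis by simp
qed

text \<open>
  A sharp boundary form of the Schwarz lemma: the function \<open>g\<close> below is nonpositive on \<open>(0, 1)\<close>
  and vanishes at \<open>1\<close>, hence cannot decrease there. The sharpness matters: the weaker Harnack
  inequality for \<open>Re f\<close> alone would lose the term in \<open>Im (f 1)\<close>.
\<close>

lemma boundary_deriv_bound:
  fixes f :: "complex \<Rightarrow> complex" and \<alpha> :: real
  assumes holo: "f holomorphic_on ball 0 1" and f0: "f 0 = 1" and "\<alpha> < 1"
    and Re: "\<And>z. cmod z < 1 \<Longrightarrow> Re (f z) > \<alpha>"
    and f1: "Re (f 1) = \<alpha>"
    and deriv: "(f has_field_derivative c) (at 1)"
  shows "(1 - \<alpha>)\<^sup>2 + (Im (f 1))\<^sup>2 \<le> - 2 * (1 - \<alpha>) * Re c"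
proof -
  define u where "u = (\<lambda>t. Re (f (of_real t)))"
  define v where "v = (\<lambda>t. Im (f (of_real t)))"
  define g where
    "g = (\<lambda>t::real. (u t - 1)\<^sup>2 + (v t)\<^sup>2 - t\<^sup>2 * ((u t + 1 - 2 * \<alpha>)\<^sup>2 + (v t)\<^sup>2))"
  have "((\<lambda>t. f (of_real t)) has_vector_derivative c) (at 1)"
    using has_vector_derivative_real_field[of f c 1] deriv by simp
  then have u: "(u has_real_derivative Re c) (at 1)"
    and v: "(v has_real_derivative Im c) (at 1)"
    by (simp_all add: u_def v_def has_vector_derivative_complex_iff)
  have u1: "u 1 = \<alpha>" by (simp add: u_def f1)
  have D: "(g has_real_derivative
      - 4 * (1 - \<alpha>) * Re c - 2 * ((1 - \<alpha>)\<^sup>2 + (v 1)\<^sup>2)) (at 1)"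
    unfolding g_def
    by (rule derivative_eq_intros u v refl | simp)+
      (simp add: u1 power2_eq_square algebra_simps)
  have g1: "g 1 = 0"
    by (simp add: g_def u1 power2_eq_square algebra_simps)
  have le: "g t \<le> 0" if "0 < t" "t < 1" for t
  proof -
    have "cmod (f (of_real t) - 1) \<le> t * cmod (f (of_real t) + 1 - 2 * of_real \<alpha>)"
      using halfplane_Schwarz[OF holo f0 \<open>\<alpha> < 1\<close> Re, of "of_real t"] that by simp
    then have "(cmod (f (of_real t) - 1))\<^sup>2
        \<le> (t * cmod (f (of_real t) + 1 - 2 * of_real \<alpha>))\<^sup>2"
      by (rule power_mono) simp
    then show ?thesis by (simp add: g_def u_def v_def power_mult_distrib cmod_power2)
  qed
  have "0 \<le> - 4 * (1 - \<alpha>) * Re c - 2 * ((1 - \<alpha>)\<^sup>2 + (v 1)\<^sup>2)"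
  proof (rule ccontr)
    assume "\<not> ?thesis"
    then obtain d where d: "d > 0" "\<And>h. 0 < h \<Longrightarrow> h < d \<Longrightarrow> g 1 < g (1 - h)"
      using DERIV_neg_dec_left[OF D] by auto
    define h where "h = min d 1 / 2"
    have "0 < h" "h < d" "h < 1" using \<open>d > 0\<close> by (auto simp: h_def)
    then show False using d(2)[of h] le[of "1 - h"] g1 by simp
  qed
  then show ?thesis by (simp add: v_def algebra_simps)
qed

text \<open>
  The mean of a positive number and its reciprocal is at least \<open>1\<close>, and \<open>b / a + a / b\<close> over a
  common denominator is the quantity that \<open>boundary_deriv_bound\<close> controls.
\<close>

lemma half_sum_ratios:
  fixes a b :: real
  assumes "a > 0" "b > 0"
  shows "1 / 2 * (b / a + a / b) = (a\<^sup>2 + b\<^sup>2) / (2 * a * b)"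
    and "1 / 2 * (b / a + a / b) \<ge> 1"
proof -
  show eq: "1 / 2 * (b / a + a / b) = (a\<^sup>2 + b\<^sup>2) / (2 * a * b)"
    using assms by (simp add: field_simps power2_eq_square)
  have "0 \<le> (a - b)\<^sup>2" by simp
  then have "2 * a * b \<le> a\<^sup>2 + b\<^sup>2" by (simp add: power2_eq_square algebra_simps)
  then show "1 / 2 * (b / a + a / b) \<ge> 1" unfolding eq using assms by simp
qed

theorem theorem1:
  fixes p :: "complex \<Rightarrow> complex" and \<alpha> \<beta> :: real and z\<^sub>0 :: complex
  assumes "p analytic_on ball 0 1"
    and "p 0 = 1"
    and "0 \<le> \<alpha>" and "\<alpha> < 1" and "\<beta> \<noteq> 0"
    and "z\<^sub>0 \<in> ball 0 1"
    and "\<And>z. cmod z < cmod z\<^sub>0 \<Longrightarrow> Re (p z) > \<alpha>"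
    and "p z\<^sub>0 = of_real \<alpha> + of_real \<beta> * \<i>"
  shows "\<exists>k :: real.
    Re (z\<^sub>0 * deriv p z\<^sub>0 / p z\<^sub>0) = - (\<alpha> * \<beta> * k / (\<alpha>\<^sup>2 + \<beta>\<^sup>2)) \<and>
    - (\<alpha> * \<beta> * k / (\<alpha>\<^sup>2 + \<beta>\<^sup>2)) \<le> 0 \<and>
    Im (z\<^sub>0 * deriv p z\<^sub>0 / p z\<^sub>0) = \<beta>\<^sup>2 * k / (\<alpha>\<^sup>2 + \<beta>\<^sup>2) \<and>
    (\<beta> > 0 \<longrightarrow>
      k \<ge> 1 / 2 * (\<beta> / (1 - \<alpha>) + (1 - \<alpha>) / \<beta>) \<and>
      1 / 2 * (\<beta> / (1 - \<alpha>) + (1 - \<alpha>) / \<beta>) \<ge> 1) \<and>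
    (\<beta> < 0 \<longrightarrow>
      k \<le> 1 / 2 * (\<beta> / (1 - \<alpha>) + (1 - \<alpha>) / \<beta>) \<and>
      1 / 2 * (\<beta> / (1 - \<alpha>) + (1 - \<alpha>) / \<beta>) \<le> -1)"
proof -
  have "z\<^sub>0 \<noteq> 0"
  proof
    assume "z\<^sub>0 = 0"
    then have "Im (p 0) = \<beta>" using assms(8) by simp
    then show False using assms(2,5) by simp
  qed
  define f where "f = (\<lambda>z. p (z\<^sub>0 * z))"
  define c where "c = z\<^sub>0 * deriv p z\<^sub>0"
  have in_disc: "z\<^sub>0 * z \<in> ball 0 1" if "cmod z \<le> 1" for z
    using assms(6) mult_left_mono[OF that, of "cmod z\<^sub>0"] by (simp add: norm_mult)
  have holo: "p holomorphic_on ball 0 1"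
    using assms(1) by (rule analytic_imp_holomorphic)
  have "(p \<circ> (*) z\<^sub>0) holomorphic_on cball 0 1"
    by (rule holomorphic_on_compose_gen[OF _ holo])
      (use in_disc in \<open>auto intro!: holomorphic_intros\<close>)
  then have f_holo: "f holomorphic_on cball 0 1" by (simp add: f_def o_def)
  have f_ball: "f holomorphic_on ball 0 1"
    using f_holo by (rule holomorphic_on_subset) auto
  have f_cont: "continuous_on (cball 0 1) f"
    using f_holo by (rule holomorphic_on_imp_continuous_on)
  have f_Re: "Re (f z) > \<alpha>" if "cmod z < 1" for z
    using assms(7) that \<open>z\<^sub>0 \<noteq> 0\<close> by (simp add: f_def norm_mult)
  have f0: "f 0 = 1" by (simp add: f_def assms(2))
  have f1: "Re (f 1) = \<alpha>" "Im (f 1) = \<beta>" by (simp_all add: f_def assms(8))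
  have "(p has_field_derivative deriv p z\<^sub>0) (at (z\<^sub>0 * 1))"
    using holomorphic_derivI[OF holo _ assms(6)] by simp
  then have f_deriv: "(f has_field_derivative c) (at 1)"
    unfolding f_def c_def
    by (rule DERIV_chain2[THEN DERIV_cong]) (auto intro!: derivative_eq_intros)
  define m where "m = - Re c"
  have c: "c = - of_real m"
    using boundary_deriv_real[OF f_cont f_Re f1(1) f_deriv] by (simp add: m_def complex_eq_iff)
  have bound: "(1 - \<alpha>)\<^sup>2 + \<beta>\<^sup>2 \<le> 2 * (1 - \<alpha>) * m"
    using boundary_deriv_bound[OF f_ball f0 assms(4) f_Re f1(1) f_deriv]
    by (simp add: f1(2) m_def algebra_simps)
  have "0 \<le> 2 * (1 - \<alpha>) * m" by (rule order_trans[OF _ bound]) simp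
  then have "0 \<le> m" using assms(4) by (simp add: zero_le_mult_iff)
  \<comment> \<open>Both \<open>k\<close> and its bound are odd in \<open>\<beta>\<close>, so estimating with \<open>\<bar>\<beta>\<bar>\<close> covers both signs.\<close>
  have sharp: "1 / 2 * (\<bar>\<beta>\<bar> / (1 - \<alpha>) + (1 - \<alpha>) / \<bar>\<beta>\<bar>) \<le> m / \<bar>\<beta>\<bar>"
  proof -
    have "((1 - \<alpha>)\<^sup>2 + \<bar>\<beta>\<bar>\<^sup>2) / (2 * (1 - \<alpha>) * \<bar>\<beta>\<bar>) \<le> 2 * (1 - \<alpha>) * m / (2 * (1 - \<alpha>) * \<bar>\<beta>\<bar>)"
      using bound assms(4,5) by (intro divide_right_mono) auto
    also have "\<dots> = m / \<bar>\<beta>\<bar>" using assms(4) by simp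
    finally show ?thesis using assms(4,5) by (subst half_sum_ratios(1)) auto
  qed
  have ge1: "1 / 2 * (\<bar>\<beta>\<bar> / (1 - \<alpha>) + (1 - \<alpha>) / \<bar>\<beta>\<bar>) \<ge> 1"
    using assms(4,5) by (intro half_sum_ratios(2)) auto
  have quot: "z\<^sub>0 * deriv p z\<^sub>0 / p z\<^sub>0 = - of_real m / (of_real \<alpha> + of_real \<beta> * \<i>)"
    using c assms(8) by (simp add: c_def)
  show ?thesis
  proof (intro exI[of _ "m / \<beta>"] conjI impI)
    show "Re (z\<^sub>0 * deriv p z\<^sub>0 / p z\<^sub>0) = - (\<alpha> * \<beta> * (m / \<beta>) / (\<alpha>\<^sup>2 + \<beta>\<^sup>2))"
      using assms(5) by (simp add: quot Re_divide)
    show "- (\<alpha> * \<beta> * (m / \<beta>) / (\<alpha>\<^sup>2 + \<beta>\<^sup>2)) \<le> 0"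
      using assms(3,5) \<open>0 \<le> m\<close> by simp
    show "Im (z\<^sub>0 * deriv p z\<^sub>0 / p z\<^sub>0) = \<beta>\<^sup>2 * (m / \<beta>) / (\<alpha>\<^sup>2 + \<beta>\<^sup>2)"
      using assms(5) by (simp add: quot Im_divide power2_eq_square)
    show "1 / 2 * (\<beta> / (1 - \<alpha>) + (1 - \<alpha>) / \<beta>) \<le> m / \<beta>" if "\<beta> > 0"
      using sharp that by simp
    show "1 \<le> 1 / 2 * (\<beta> / (1 - \<alpha>) + (1 - \<alpha>) / \<beta>)" if "\<beta> > 0"
      using ge1 that by simp
    show "m / \<beta> \<le> 1 / 2 * (\<beta> / (1 - \<alpha>) + (1 - \<alpha>) / \<beta>)" if "\<beta> < 0"
      using sharp that by simp
    show "1 / 2 * (\<beta> / (1 - \<alpha>) + (1 - \<alpha>) / \<beta>) \<le> -1" if "\<beta> < 0"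
      using ge1 that by simp
  qed
qed

end
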